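(* Let $U$ be a finite set, let $\mathbf{C}$ be a covering of $U$, and let $\mathcal{I}_{\mathbf{C}}\subseteq\mathbb{D}(U,\mathbf{C})$. Then $M_{\mathbf{C}}=(U,\mathcal{I}_{\mathbf{C}})$ is a rough matroid based on $\mathbf{C}$ if and only if $\mathcal{I}_{\mathbf{C}}$ satisfies the following three conditions: (1) $\emptyset\in\mathcal{I}_{\mathbf{C}}$; (2) if $I\in\mathcal{I}_{\mathbf{C}}$, $I'\subseteq I$ and $I'\in\mathbb{D}(U,\mathbf{C})$, then $I'\in\mathcal{I}_{\mathbf{C}}$; (3) for every $D\in\mathbb{D}(U,\mathbf{C})$, all the maximal (with respect to inclusion) subsets of $D$ which are contained in $\mathcal{I}_{\mathbf{C}}$ (that is, the maximal members of $\{I\in\mathcal{I}_{\mathbf{C}}: I\subseteq D\}$) have the same cardinality.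
   Context: A covering $\mathbf{C}$ of $U$ is a family of nonempty subsets of $U$ with $\bigcup\mathbf{C}=U$. For $x\in U$, the neighborhood of $x$ is $N_{\mathbf{C}}(x)=\bigcap\{K\in\mathbf{C}: x\in K\}$. A subset $X\subseteq U$ is called a definable set with respect to $\mathbf{C}$ if $X=\bigcup_{x\in X}N_{\mathbf{C}}(x)$; in particular $\emptyset$ is definable. $\mathbb{D}(U,\mathbf{C})$ denotes the family of all definable sets with respect to $\mathbf{C}$. A rough matroid based on $\mathbf{C}$ is an ordered pair $M_{\mathbf{C}}=(U,\mathcal{I}_{\mathbf{C}})$ where $\mathcal{I}_{\mathbf{C}}\subseteq\mathbb{D}(U,\mathbf{C})$ satisfies: (CI1) $\emptyset\in\mathcal{I}_{\mathbf{C}}$; (CI2) if $I\in\mathcal{I}_{\mathbf{C}}$, $I'\subseteq I$ and $I'\in\mathbb{D}(U,\mathbf{C})$, then $I'\in\mathcal{I}_{\mathbf{C}}$; (CI3) if $I_1,I_2\in\mathcal{I}_{\mathbf{C}}$ and $|I_1|<|I_2|$, then there exists $I\in\mathcal{I}_{\mathbf{C}}$ such that $I_1\subset I\subseteq I_1\cup I_2$, where $\subset$ denotes proper inclusion. *)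

theory Defs
  imports Main
begin

definition covering :: "'a set \<Rightarrow> 'a set set \<Rightarrow> bool" where
  "covering U C \<longleftrightarrow> (\<forall>K\<in>C. K \<noteq> {} \<and> K \<subseteq> U) \<and> \<Union>C = U"

(* Only meaningful for x in U: if no member of C contains x, this is UNIV. *)
definition neighborhood :: "'a set set \<Rightarrow> 'a \<Rightarrow> 'a set" where
  "neighborhood C x = \<Inter>{K \<in> C. x \<in> K}"

definition definable_sets :: "'a set \<Rightarrow> 'a set set \<Rightarrow> 'a set set" where
  "definable_sets U C = {X. X \<subseteq> U \<and> X = (\<Union>x\<in>X. neighborhood C x)}"

(* The ordered pair (U, \<I>) is a rough matroid based on C; C is meant to be a covering of U. *)
definition rough_matroid :: "'a set \<Rightarrow> 'a set set \<Rightarrow> 'a set set \<Rightarrow> bool" where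
  "rough_matroid U C \<I> \<longleftrightarrow>
     \<I> \<subseteq> definable_sets U C \<and>
     {} \<in> \<I> \<and>
     (\<forall>I I'. I \<in> \<I> \<and> I' \<subseteq> I \<and> I' \<in> definable_sets U C \<longrightarrow> I' \<in> \<I>) \<and>
     (\<forall>I1\<in>\<I>. \<forall>I2\<in>\<I>. card I1 < card I2 \<longrightarrow> (\<exists>I\<in>\<I>. I1 \<subset> I \<and> I \<subseteq> I1 \<union> I2))"

definition maximal_members_within :: "'a set set \<Rightarrow> 'a set \<Rightarrow> 'a set set" where
  "maximal_members_within \<I> D =
     {I \<in> \<I>. I \<subseteq> D \<and> \<not> (\<exists>J\<in>\<I>. J \<subseteq> D \<and> I \<subset> J)}"

end

theory Submission
  imports Defs
begin

text \<open>The first two conditions are common to both sides, so the point is that exchange is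
  equivalent to equal cardinality of maximal members. If \<open>A\<close> and \<open>B\<close> are
  maximal within \<open>D\<close> and \<open>A\<close> is smaller, exchange enlarges
  \<open>A\<close> inside \<open>A \<union> B\<close>, hence inside \<open>D\<close>, against
  maximality (\<open>card_maximal_members_within_le\<close>). Conversely, the condition is applied
  to \<open>D = I1 \<union> I2\<close>, which is definable by \<open>definable_sets_Un\<close>: the
  larger set \<open>I2\<close> lies below some maximal member, so the smaller \<open>I1\<close>
  cannot be maximal there (\<open>augmentation_of_equicardinal_maximal_members\<close>).\<close>

lemma definable_sets_Un:
  assumes "X \<in> definable_sets U C" and "Y \<in> definable_sets U C"
  shows "X \<union> Y \<in> definable_sets U C"
  using assms unfolding definable_sets_def by (simp add: UN_Un)

text \<open>A finite \<open>D\<close> has finitely many subsets, so a member of \<open>\<I>\<close>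
  inside it cannot be enlarged forever.\<close>

lemma maximal_member_above:
  assumes "finite D" and "I \<in> \<I>" and "I \<subseteq> D"
  obtains B where "B \<in> maximal_members_within \<I> D" and "I \<subseteq> B"
proof -
  let ?S = "{J \<in> \<I>. J \<subseteq> D}"
  have "finite ?S"
    using assms(1) by (auto intro: finite_subset[of _ "Pow D"])
  moreover have "I \<in> ?S"
    using assms(2,3) by simp
  ultimately obtain B where "B \<in> ?S" "I \<subseteq> B" and "\<forall>J\<in>?S. B \<subseteq> J \<longrightarrow> B = J"
    by (rule finite_has_maximal2[THEN bexE]) simp
  then have "B \<in> maximal_members_within \<I> D"
    unfolding maximal_members_within_def by auto
  then show thesis
    using \<open>I \<subseteq> B\<close> by (rule that)
qed

lemma card_maximal_members_within_le:
  assumes aug: "\<And>I1 I2. \<lbrakk>I1 \<in> \<I>; I2 \<in> \<I>; card I1 < card I2\<rbrakk> \<Longrightarrow> \<exists>I\<in>\<I>. I1 \<subset> I \<and> I \<subseteq> I1 \<union> I2"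
    and A: "A \<in> maximal_members_within \<I> D" and B: "B \<in> maximal_members_within \<I> D"
  shows "card B \<le> card A"
proof (rule ccontr)
  assume "\<not> card B \<le> card A"
  then have "card A < card B"
    by simp
  moreover have "A \<in> \<I>" "B \<in> \<I>" "A \<union> B \<subseteq> D"
    using A B unfolding maximal_members_within_def by simp_all
  ultimately obtain I where "I \<in> \<I>" "A \<subset> I" "I \<subseteq> D"
    using aug[of A B] by auto
  then show False
    using A unfolding maximal_members_within_def by simp
qed

text \<open>Failure of \<open>I1\<close> to be maximal within \<open>I1 \<union> I2\<close> is
  exactly the augmentation sought. It does fail, because a maximal member above \<open>I2\<close>
  has more elements than \<open>I1\<close>.\<close>

lemma augmentation_of_equicardinal_maximal_members:
  assumes "finite (I1 \<union> I2)" and "I1 \<in> \<I>" and "I2 \<in> \<I>" and "card I1 < card I2"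
    and "\<And>A B. \<lbrakk>A \<in> maximal_members_within \<I> (I1 \<union> I2); B \<in> maximal_members_within \<I> (I1 \<union> I2)\<rbrakk>
      \<Longrightarrow> card A = card B"
  shows "\<exists>I\<in>\<I>. I1 \<subset> I \<and> I \<subseteq> I1 \<union> I2"
proof -
  obtain B where B: "B \<in> maximal_members_within \<I> (I1 \<union> I2)" "I2 \<subseteq> B"
    using maximal_member_above[of "I1 \<union> I2" I2] assms(1,3) by blast
  \<comment> \<open>Monotonicity of \<open>card\<close> needs this, since \<open>card\<close> is 0
    on infinite sets.\<close>
  have "finite B"
    using B(1) assms(1) finite_subset unfolding maximal_members_within_def by blast
  then have "card I1 < card B"
    using card_mono[OF _ B(2)] assms(4) by simp
  then have "I1 \<notin> maximal_members_within \<I> (I1 \<union> I2)"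
    using assms(5)[OF _ B(1)] by force
  then show ?thesis
    using assms(2) unfolding maximal_members_within_def by blast
qed

theorem proposition8:
  fixes U :: "'a set" and C \<I> :: "'a set set"
  assumes "finite U"
    and "covering U C"
    and "\<I> \<subseteq> definable_sets U C"
  shows "rough_matroid U C \<I> \<longleftrightarrow>
    {} \<in> \<I> \<and>
    (\<forall>I I'. I \<in> \<I> \<and> I' \<subseteq> I \<and> I' \<in> definable_sets U C \<longrightarrow> I' \<in> \<I>) \<and>
    (\<forall>D\<in>definable_sets U C.
       \<forall>A\<in>maximal_members_within \<I> D. \<forall>B\<in>maximal_members_within \<I> D. card A = card B)"
proof -
  let ?aug = "\<forall>I1\<in>\<I>. \<forall>I2\<in>\<I>. card I1 < card I2 \<longrightarrow> (\<exists>I\<in>\<I>. I1 \<subset> I \<and> I \<subseteq> I1 \<union> I2)"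
  let ?eqcard = "\<forall>D\<in>definable_sets U C.
    \<forall>A\<in>maximal_members_within \<I> D. \<forall>B\<in>maximal_members_within \<I> D. card A = card B"
  have "?eqcard" if "?aug"
    \<comment> \<open>Antisymmetry splits the equality into two inequalities; the lemma gives both,
      with \<open>A\<close> and \<open>B\<close> exchanged.\<close>
    using that by (intro ballI antisym card_maximal_members_within_le[where \<I> = \<I>]) blast+
  moreover have "?aug" if eqcard: "?eqcard"
  proof (intro ballI impI)
    fix I1 I2
    assume I: "I1 \<in> \<I>" "I2 \<in> \<I>" "card I1 < card I2"
    \<comment> \<open>Definability of the members of \<open>\<I>\<close> makes their union an
      admissible \<open>D\<close> for the cardinality condition.\<close>
    then have D: "I1 \<union> I2 \<in> definable_sets U C"
      using assms(3) definable_sets_Un by blast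
    then have "finite (I1 \<union> I2)"
      using assms(1) finite_subset unfolding definable_sets_def by blast
    then show "\<exists>I\<in>\<I>. I1 \<subset> I \<and> I \<subseteq> I1 \<union> I2"
      using I by (rule augmentation_of_equicardinal_maximal_members)
        (use eqcard D in blast)
  qed
  ultimately have "?aug \<longleftrightarrow> ?eqcard"
    by argo
  then show ?thesis
    using assms(3) unfolding rough_matroid_def by simp
qed

end
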